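(* Let $(X,L)$ be a regular, hereditarily Lindelöf convergence space. If Bob has a winning strategy in $\mathsf G_{\mathrm{fin}}(\mathcal C_L,\operatorname{Cov}(X))$, then $X$ is a countable union of $L$-compactoid subsets.
   Context: All filters are proper. $\operatorname{Fil}(X)$ is the set of filters on $X$, and $\dot x=\{A\subseteq X:x\in A\}$. A convergence on $X$ is a function $L:\operatorname{Fil}(X)\to\mathcal P(X)$ such that $x\in L(\dot x)$ for every $x\in X$, and $L(\mathcal F)\subseteq L(\mathcal G)$ whenever $\mathcal F\subseteq\mathcal G$; then $(X,L)$ is a convergence space. Write $\mathcal F\to_L x$ for $x\in L(\mathcal F)$, and $\Sigma_L=\{\mathcal F\in\operatorname{Fil}(X):L(\mathcal F)\neq\varnothing\}$. For a filter $\mathcal F$ and a set $A$, $\mathcal F\mathrel{\#}A$ means $F\cap A\neq\varnothing$ for every $F\in\mathcal F$. Put $\operatorname{cl}_LA=\{x\in X:\mathcal F\to_Lx\text{ for some }\mathcal F\mathrel{\#}A\}$. $L$ is regular if $\mathcal F\to_L x$ implies that the filter generated by $\{\operatorname{cl}_LF:F\in\mathcal F\}$ also converges to $x$. A set $K\subseteq X$ is $L$-compactoid if every ultrafilter $\mathfrak p$ on $X$ with $K\in\mathfrak p$ satisfies $L(\mathfrak p)\neq\varnothing$. A family $\mathcal U\subseteq\mathcal P(X)$ is an $L$-cover if $\mathcal U\cap\mathcal F\neq\varnothing$ for every $\mathcal F\in\Sigma_L$; $\mathcal C_L$ is the family of all $L$-covers. $\operatorname{Cov}(X)$ is the family of all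 covers of $X$ by subsets of $X$. A subfamily $\mathcal V$ of an $L$-cover $\mathcal U$ is a basic subcovering if for every $\mathcal F\in\Sigma_L$ some finite $\mathcal E\subseteq\mathcal V$ satisfies $\bigcup\mathcal E\in\mathcal F$. A convergence space is Lindelöf (in Feldman's sense) if every $L$-cover has a countable basic subcovering. For $Y\subseteq X$ and $\mathcal F\in\operatorname{Fil}(Y)$ put $\mathcal F^{\uparrow X}=\{A\subseteq X:A\cap Y\in\mathcal F\}$; the subspace convergence $L|_Y$ on $Y$ is defined by $\mathcal F\to_{L|_Y}y$ iff $\mathcal F^{\uparrow X}\to_Ly$. $(X,L)$ is hereditarily Lindelöf if $(Y,L|_Y)$ is Lindelöf for every $Y\subseteq X$. In the game $\mathsf G_{\mathrm{fin}}(\mathcal A,\mathcal B)$, in each inning $n<\omega$ Alice chooses $\mathcal U_n\in\mathcal A$ and then Bob chooses a finite subfamily $\mathcal V_n\subseteq\mathcal U_n$; Bob wins if $\bigcup_{n<\omega}\mathcal V_n\in\mathcal B$, otherwise Alice wins. *)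

theory Defs
  imports Main "HOL-Library.Countable_Set"
begin

text \<open>
  The library type of filters lives on a whole type and contains the improper filter \<^term>\<open>bot\<close>.
  A proper filter on a set \<open>X\<close> is represented by the type-level filter it generates,
  \<open>{A. A \<inter> X \<in> F}\<close>.  This is a bijection onto the proper filters that contain \<open>X\<close>, and a subset
  of \<open>X\<close> belongs to the one iff it belongs to the other.  For \<open>Y \<subseteq> X\<close>, a filter on \<open>Y\<close> and its
  extension to \<open>X\<close> have the same representation.

  Note that the library orders filters by \<^emph>\<open>reverse\<close> inclusion: \<open>F \<le> G\<close> means that every member
  of \<open>G\<close> is a member of \<open>F\<close>.
\<close>

definition mem_filter :: "'a set \<Rightarrow> 'a filter \<Rightarrow> bool" where
  "mem_filter A F \<longleftrightarrow> eventually (\<lambda>x. x \<in> A) F"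

definition Fil :: "'a set \<Rightarrow> 'a filter set" where
  "Fil X = {F. F \<noteq> bot \<and> mem_filter X F}"

definition ultrafilter_on :: "'a set \<Rightarrow> 'a filter \<Rightarrow> bool" where
  "ultrafilter_on X p \<longleftrightarrow> p \<in> Fil X \<and> (\<forall>G\<in>Fil X. G \<le> p \<longrightarrow> G = p)"

text \<open>
  A convergence on \<open>X\<close> is a function \<open>L\<close> on type-level filters; its values outside \<open>Fil X\<close> are
  irrelevant in all the definitions below.
\<close>

definition convergence_space :: "'a set \<Rightarrow> ('a filter \<Rightarrow> 'a set) \<Rightarrow> bool" where
  "convergence_space X L \<longleftrightarrow>
     (\<forall>F\<in>Fil X. L F \<subseteq> X) \<and>
     (\<forall>x\<in>X. x \<in> L (principal {x})) \<and>
     (\<forall>F\<in>Fil X. \<forall>G\<in>Fil X. G \<le> F \<longrightarrow> L F \<subseteq> L G)"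

definition convergent_filters :: "'a set \<Rightarrow> ('a filter \<Rightarrow> 'a set) \<Rightarrow> 'a filter set" where
  "convergent_filters X L = {F \<in> Fil X. L F \<noteq> {}}"

definition meshes :: "'a filter \<Rightarrow> 'a set \<Rightarrow> bool" where
  "meshes F A \<longleftrightarrow> (\<forall>B. mem_filter B F \<longrightarrow> B \<inter> A \<noteq> {})"

definition conv_closure :: "'a set \<Rightarrow> ('a filter \<Rightarrow> 'a set) \<Rightarrow> 'a set \<Rightarrow> 'a set" where
  "conv_closure X L A = {x \<in> X. \<exists>F\<in>Fil X. meshes F A \<and> x \<in> L F}"

text \<open>The infimum of principal filters is the filter generated by the given sets.\<close>

definition closure_filter :: "'a set \<Rightarrow> ('a filter \<Rightarrow> 'a set) \<Rightarrow> 'a filter \<Rightarrow> 'a filter" where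
  "closure_filter X L F = (INF A\<in>{A. A \<subseteq> X \<and> mem_filter A F}. principal (conv_closure X L A))"

definition regular_convergence :: "'a set \<Rightarrow> ('a filter \<Rightarrow> 'a set) \<Rightarrow> bool" where
  "regular_convergence X L \<longleftrightarrow> (\<forall>F\<in>Fil X. \<forall>x\<in>L F. x \<in> L (closure_filter X L F))"

definition compactoid :: "'a set \<Rightarrow> ('a filter \<Rightarrow> 'a set) \<Rightarrow> 'a set \<Rightarrow> bool" where
  "compactoid X L K \<longleftrightarrow> K \<subseteq> X \<and> (\<forall>p. ultrafilter_on X p \<and> mem_filter K p \<longrightarrow> L p \<noteq> {})"

definition conv_covers :: "'a set \<Rightarrow> ('a filter \<Rightarrow> 'a set) \<Rightarrow> 'a set set set" where
  "conv_covers X L =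
     {\<U>. \<U> \<subseteq> Pow X \<and> (\<forall>F\<in>convergent_filters X L. \<exists>U\<in>\<U>. mem_filter U F)}"

definition set_covers :: "'a set \<Rightarrow> 'a set set set" where
  "set_covers X = {\<U>. \<U> \<subseteq> Pow X \<and> \<Union>\<U> = X}"

definition basic_subcovering ::
    "'a set \<Rightarrow> ('a filter \<Rightarrow> 'a set) \<Rightarrow> 'a set set \<Rightarrow> 'a set set \<Rightarrow> bool" where
  "basic_subcovering X L \<U> \<V> \<longleftrightarrow>
     \<V> \<subseteq> \<U> \<and>
     (\<forall>F\<in>convergent_filters X L. \<exists>\<E>. finite \<E> \<and> \<E> \<subseteq> \<V> \<and> mem_filter (\<Union>\<E>) F)"

definition Lindelof_convergence :: "'a set \<Rightarrow> ('a filter \<Rightarrow> 'a set) \<Rightarrow> bool" where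
  "Lindelof_convergence X L \<longleftrightarrow>
     (\<forall>\<U>\<in>conv_covers X L. \<exists>\<V>. countable \<V> \<and> basic_subcovering X L \<U> \<V>)"

text \<open>No extension map occurs here, because the extension of \<open>F\<close> to \<open>X\<close> is represented by \<open>F\<close>.\<close>

definition subspace_convergence :: "('a filter \<Rightarrow> 'a set) \<Rightarrow> 'a set \<Rightarrow> 'a filter \<Rightarrow> 'a set" where
  "subspace_convergence L Y F = {y \<in> Y. y \<in> L F}"

definition hereditarily_Lindelof :: "'a set \<Rightarrow> ('a filter \<Rightarrow> 'a set) \<Rightarrow> bool" where
  "hereditarily_Lindelof X L \<longleftrightarrow>
     (\<forall>Y\<subseteq>X. Lindelof_convergence Y (subspace_convergence L Y))"

text \<open>
  A strategy \<open>\<sigma>\<close> for Bob maps the nonempty list of the moves Alice has made so far (the latest one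
  last) to Bob's answer in the current inning.
\<close>

definition Gfin_Bob_strategy :: "'m set set \<Rightarrow> ('m set list \<Rightarrow> 'm set) \<Rightarrow> bool" where
  "Gfin_Bob_strategy \<A> \<sigma> \<longleftrightarrow>
     (\<forall>us. us \<noteq> [] \<and> set us \<subseteq> \<A> \<longrightarrow> finite (\<sigma> us) \<and> \<sigma> us \<subseteq> last us)"

definition Gfin_Bob_has_winning_strategy :: "'m set set \<Rightarrow> 'm set set \<Rightarrow> bool" where
  "Gfin_Bob_has_winning_strategy \<A> \<B> \<longleftrightarrow>
     (\<exists>\<sigma>. Gfin_Bob_strategy \<A> \<sigma> \<and>
       (\<forall>\<U> :: nat \<Rightarrow> 'm set. (\<forall>n. \<U> n \<in> \<A>) \<longrightarrow>
          (\<Union>n. \<sigma> (map \<U> [0..<Suc n])) \<in> \<B>))"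

end

theory Submission imports Defs begin

text \<open>
  For a position \<open>s\<close> of the game let \<open>K\<^sub>s\<close> be the intersection, over all possible next moves \<open>\<U>\<close> of
  Alice, of the closures of \<open>\<Union>\<sigma>(s\<frown>\<U>)\<close>.  It is compactoid: if an ultrafilter \<open>p\<close> containing \<open>K\<^sub>s\<close> did
  not converge, then by regularity the sets whose closure is not in \<open>p\<close> would form an \<open>L\<close>-cover, and
  Bob's answer to it would contradict \<open>K\<^sub>s \<in> p\<close>.  On \<open>Y = X - K\<^sub>s\<close> the sets \<open>Y - \<Union>\<sigma>(s\<frown>\<U>)\<close> form a
  cover for the subspace convergence, so the Lindelof property leaves countably many moves \<open>\<U>\<close> such
  that each point of \<open>Y\<close> is missed by one of the answers.  Allowing Alice these moves only gives a
  countable tree of positions; a point outside all its \<open>K\<^sub>s\<close> would be missed along a whole branch.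
\<close>

lemma mem_filter_mono: "mem_filter A F \<Longrightarrow> A \<subseteq> B \<Longrightarrow> mem_filter B F"
  unfolding mem_filter_def by (auto elim: eventually_mono)

lemma mem_filter_Int: "mem_filter (A \<inter> B) F \<longleftrightarrow> mem_filter A F \<and> mem_filter B F"
  unfolding mem_filter_def by (simp add: eventually_conj_iff)

lemma mem_filter_iff_le: "mem_filter A F \<longleftrightarrow> F \<le> principal A"
  unfolding mem_filter_def by (simp add: le_principal)

lemma not_mem_filter_empty: "F \<in> Fil X \<Longrightarrow> \<not> mem_filter {} F"
  unfolding Fil_def mem_filter_def by (simp add: trivial_limit_def)

text \<open>If \<open>A\<close> is not in \<open>p\<close>, adjoining \<open>- A\<close> to
  \<open>p\<close> still gives a proper filter, so by maximality \<open>- A\<close> was in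
  \<open>p\<close> already.\<close>

lemma ultrafilter_on_Un:
  assumes "ultrafilter_on X p" and "mem_filter (A \<union> B) p" and "\<not> mem_filter A p"
  shows "mem_filter B p"
proof -
  let ?G = "inf p (principal (- A))"
  have "?G \<noteq> bot"
    using assms(3) unfolding trivial_limit_def eventually_inf_principal mem_filter_def by simp
  moreover have "mem_filter X ?G"
    using assms(1) unfolding ultrafilter_on_def Fil_def mem_filter_iff_le
    by (auto intro: le_infI1)
  ultimately have "?G = p"
    using assms(1) unfolding ultrafilter_on_def Fil_def by auto
  hence "mem_filter (- A) p"
    unfolding mem_filter_iff_le by (metis inf_le2)
  hence "mem_filter ((A \<union> B) \<inter> - A) p"
    using assms(2) by (simp add: mem_filter_Int)
  thus ?thesis by (rule mem_filter_mono) auto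
qed

lemma ultrafilter_on_finite_Union:
  assumes "ultrafilter_on X p" and "finite \<E>" and "mem_filter (\<Union>\<E>) p"
  shows "\<exists>E\<in>\<E>. mem_filter E p"
  using assms(2,3)
proof (induction \<E>)
  case empty
  thus ?case using assms(1) not_mem_filter_empty unfolding ultrafilter_on_def by fastforce
next
  case (insert E \<E>)
  thus ?case using ultrafilter_on_Un[OF assms(1), of E "\<Union>\<E>"] by auto
qed

lemma conv_closure_subset: "conv_closure X L A \<subseteq> X"
  unfolding conv_closure_def by auto

lemma conv_closure_empty: "conv_closure X L {} = {}"
  unfolding conv_closure_def meshes_def Fil_def by auto

text \<open>If members \<open>C\<close> and \<open>D\<close> of \<open>F\<close> miss
  \<open>A\<close> and \<open>B\<close> respectively, their intersection is a member missing
  both.\<close>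

lemma meshes_Un: "meshes F (A \<union> B) \<Longrightarrow> meshes F A \<or> meshes F B"
proof (rule ccontr)
  assume AB: "meshes F (A \<union> B)" and "\<not> (meshes F A \<or> meshes F B)"
  then obtain C D where "mem_filter C F" "C \<inter> A = {}" "mem_filter D F" "D \<inter> B = {}"
    unfolding meshes_def by blast
  moreover from this have "mem_filter (C \<inter> D) F" by (simp add: mem_filter_Int)
  ultimately show False using AB unfolding meshes_def by blast
qed

lemma conv_closure_Un_subset:
  "conv_closure X L (A \<union> B) \<subseteq> conv_closure X L A \<union> conv_closure X L B"
  using meshes_Un unfolding conv_closure_def by fastforce

lemma conv_closure_finite_Union_subset:
  "finite \<E> \<Longrightarrow> conv_closure X L (\<Union>\<E>) \<subseteq> (\<Union>E\<in>\<E>. conv_closure X L E)"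
proof (induction \<E> rule: finite_induct)
  case empty
  show ?case by (simp add: conv_closure_empty)
next
  case (insert E \<E>)
  thus ?case using conv_closure_Un_subset[of X L E "\<Union>\<E>"] by auto
qed

lemma not_in_conv_closure_imp_mem_filter:
  assumes "F \<in> Fil X" "x \<in> X" "x \<in> L F" "x \<notin> conv_closure X L A"
  shows "mem_filter (- A) F"
proof -
  have "\<not> meshes F A" using assms unfolding conv_closure_def by blast
  then obtain B where "mem_filter B F" "B \<inter> A = {}" unfolding meshes_def by blast
  thus ?thesis by (auto intro: mem_filter_mono)
qed

definition next_kernel ::
    "'a set \<Rightarrow> ('a filter \<Rightarrow> 'a set) \<Rightarrow> ('a set set list \<Rightarrow> 'a set set) \<Rightarrow> 'a set set list \<Rightarrow> 'a set"
  where "next_kernel X L \<sigma> s = {x \<in> X. \<forall>\<U>\<in>conv_covers X L. x \<in> conv_closure X L (\<Union>(\<sigma> (s @ [\<U>])))}"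

text \<open>If some convergent \<open>F\<close> had no member in this family, \<open>p\<close> would
  be finer than \<open>closure_filter X L F\<close>, which converges by regularity; hence
  \<open>p\<close> would converge.\<close>

lemma nonconvergent_ultrafilter_cover:
  assumes conv: "convergence_space X L" and reg: "regular_convergence X L"
    and p: "ultrafilter_on X p" and nonconv: "L p = {}"
  shows "{A. A \<subseteq> X \<and> \<not> mem_filter (conv_closure X L A) p} \<in> conv_covers X L"
proof -
  have "\<exists>A. A \<subseteq> X \<and> mem_filter A F \<and> \<not> mem_filter (conv_closure X L A) p"
    if "F \<in> convergent_filters X L" for F
  proof (rule ccontr)
    assume "\<not> ?thesis"
    hence le: "p \<le> closure_filter X L F"
      unfolding closure_filter_def by (auto simp: le_INF_iff mem_filter_iff_le)
    from that obtain x where F: "F \<in> Fil X" and x: "x \<in> L F"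
      unfolding convergent_filters_def by auto
    have p_Fil: "p \<in> Fil X" using p unfolding ultrafilter_on_def by simp
    have "mem_filter X F" using F unfolding Fil_def by simp
    \<comment> \<open>Monotonicity of \<open>L\<close> applies only inside \<open>Fil X\<close>. The
      generator coming from \<open>A = X\<close> shows that the closure filter contains
      \<open>X\<close>; it is proper because \<open>p\<close> is finer.\<close>
    hence "closure_filter X L F \<le> principal (conv_closure X L X)"
      unfolding closure_filter_def by (intro INF_lower) simp
    also have "\<dots> \<le> principal X" using conv_closure_subset by simp
    finally have "closure_filter X L F \<in> Fil X"
      using le p_Fil unfolding Fil_def mem_filter_iff_le by (auto simp: bot_unique)
    hence "L (closure_filter X L F) \<subseteq> L p"
      using conv p_Fil le unfolding convergence_space_def by blast
    thus False
      using reg F x nonconv unfolding regular_convergence_def by blast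
  qed
  thus ?thesis unfolding conv_covers_def by blast
qed

text \<open>Bob's answer is finite, so the closure of its union lies in a finite union of closures.
  An ultrafilter containing that union contains one of them, yet the cover was built from sets whose
  closure is not in \<open>p\<close>.\<close>

lemma compactoid_next_kernel:
  assumes conv: "convergence_space X L" and reg: "regular_convergence X L"
    and \<sigma>: "Gfin_Bob_strategy (conv_covers X L) \<sigma>" and s: "set s \<subseteq> conv_covers X L"
  shows "compactoid X L (next_kernel X L \<sigma> s)"
  unfolding compactoid_def
proof (intro conjI allI impI notI)
  show "next_kernel X L \<sigma> s \<subseteq> X" unfolding next_kernel_def by auto
next
  fix p
  assume "ultrafilter_on X p \<and> mem_filter (next_kernel X L \<sigma> s) p" and nonconv: "L p = {}"
  hence p: "ultrafilter_on X p" and K: "mem_filter (next_kernel X L \<sigma> s) p" by auto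
  let ?U = "{A. A \<subseteq> X \<and> \<not> mem_filter (conv_closure X L A) p}"
  let ?V = "\<sigma> (s @ [?U])"
  have U: "?U \<in> conv_covers X L"
    by (rule nonconvergent_ultrafilter_cover[OF conv reg p nonconv])
  have "s @ [?U] \<noteq> []" "set (s @ [?U]) \<subseteq> conv_covers X L" using s U by auto
  hence "finite ?V \<and> ?V \<subseteq> last (s @ [?U])"
    using \<sigma> unfolding Gfin_Bob_strategy_def by blast
  hence V: "finite ?V" "?V \<subseteq> ?U" by auto
  have "next_kernel X L \<sigma> s \<subseteq> conv_closure X L (\<Union>?V)"
    using U unfolding next_kernel_def by blast
  also have "\<dots> \<subseteq> \<Union>(conv_closure X L ` ?V)"
    by (rule conv_closure_finite_Union_subset[OF V(1)])
  finally have "mem_filter (\<Union>(conv_closure X L ` ?V)) p"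
    by (rule mem_filter_mono[OF K])
  then obtain A where "A \<in> ?V" "mem_filter (conv_closure X L A) p"
    using ultrafilter_on_finite_Union[OF p, of "conv_closure X L ` ?V"] V(1) by auto
  thus False using V(2) by blast
qed

lemma countable_moves_outside_next_kernel:
  assumes conv: "convergence_space X L" and lin: "hereditarily_Lindelof X L"
  shows "\<exists>\<W>. countable \<W> \<and> \<W> \<subseteq> conv_covers X L \<and>
    (\<forall>x \<in> X - next_kernel X L \<sigma> s. \<exists>\<U>\<in>\<W>. x \<notin> \<Union>(\<sigma> (s @ [\<U>])))"
proof -
  define Y where "Y = X - next_kernel X L \<sigma> s"
  define h where "h \<U> = Y - \<Union>(\<sigma> (s @ [\<U>]))" for \<U>
  let ?LY = "subspace_convergence L Y"
  have YX: "Y \<subseteq> X" unfolding Y_def by auto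
  have "h ` conv_covers X L \<in> conv_covers Y ?LY"
    unfolding conv_covers_def[of Y]
  proof (intro CollectI conjI ballI)
    show "h ` conv_covers X L \<subseteq> Pow Y" unfolding h_def by auto
  next
    fix F assume "F \<in> convergent_filters Y ?LY"
    then obtain y where F: "F \<in> Fil Y" and y: "y \<in> Y" "y \<in> L F"
      unfolding convergent_filters_def subspace_convergence_def by auto
    \<comment> \<open>A filter on \<open>Y\<close> and its extension to \<open>X\<close> are the
      same object here, so closures in \<open>X\<close> can be tested with \<open>F\<close>.\<close>
    have FX: "F \<in> Fil X" using F YX mem_filter_mono unfolding Fil_def by blast
    obtain \<U> where \<U>: "\<U> \<in> conv_covers X L" "y \<notin> conv_closure X L (\<Union>(\<sigma> (s @ [\<U>])))"
      using y(1) unfolding Y_def next_kernel_def by blast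
    have "mem_filter (- \<Union>(\<sigma> (s @ [\<U>]))) F"
      using not_in_conv_closure_imp_mem_filter[OF FX _ y(2) \<U>(2)] y(1) YX by blast
    hence "mem_filter (h \<U>) F"
      using F unfolding h_def Diff_eq mem_filter_Int Fil_def by simp
    thus "\<exists>U\<in>h ` conv_covers X L. mem_filter U F" using \<U>(1) by blast
  qed
  moreover have "Lindelof_convergence Y ?LY"
    using lin YX unfolding hereditarily_Lindelof_def by blast
  ultimately obtain \<V> where \<V>: "countable \<V>"
      "basic_subcovering Y ?LY (h ` conv_covers X L) \<V>"
    unfolding Lindelof_convergence_def by blast
  \<comment> \<open>Choosing one move for each member of \<open>\<V>\<close> keeps the set of moves
    countable.\<close>
  then obtain \<W> where \<W>: "countable \<W>" "\<W> \<subseteq> conv_covers X L" "\<V> = h ` \<W>"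
    unfolding basic_subcovering_def by (metis countable_subset_image)
  have "\<exists>\<U>\<in>\<W>. x \<notin> \<Union>(\<sigma> (s @ [\<U>]))" if x: "x \<in> Y" for x
  proof -
    \<comment> \<open>Point filters converge, so a basic subcovering covers \<open>Y\<close>
      pointwise.\<close>
    have "principal {x} \<in> convergent_filters Y ?LY"
      using x YX conv
      unfolding convergent_filters_def Fil_def subspace_convergence_def convergence_space_def
      by (auto simp: mem_filter_iff_le principal_eq_bot_iff)
    then obtain \<E> where "\<E> \<subseteq> \<V>" "mem_filter (\<Union>\<E>) (principal {x})"
      using \<V>(2) unfolding basic_subcovering_def by blast
    hence "x \<in> \<Union>\<V>" by (auto simp: mem_filter_iff_le)
    thus ?thesis unfolding \<W>(3) h_def by blast
  qed
  thus ?thesis using \<W> unfolding Y_def by blast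
qed

text \<open>Bob's replies are determined by his strategy, so a position is recorded by Alice's moves
  alone; \<open>W s\<close> holds those allowed to her after \<open>s\<close>.\<close>

primrec move_tree :: "('m list \<Rightarrow> 'm set) \<Rightarrow> nat \<Rightarrow> 'm list set" where
  "move_tree W 0 = {[]}"
| "move_tree W (Suc n) = (\<Union>s\<in>move_tree W n. (\<lambda>u. s @ [u]) ` W s)"

lemma set_move_tree_subset:
  assumes "\<And>s. W s \<subseteq> C" and "s \<in> move_tree W n"
  shows "set s \<subseteq> C"
  using assms(2)
proof (induction n arbitrary: s)
  case (Suc n)
  then obtain t u where "t \<in> move_tree W n" "u \<in> W t" "s = t @ [u]" by auto
  thus ?case using Suc.IH assms(1) by auto
qed simp

lemma countable_move_tree:
  assumes "\<And>s. countable (W s)"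
  shows "countable (move_tree W n)"
  using assms by (induction n) auto

theorem theorem4p7:
  fixes X :: "'a set" and L :: "'a filter \<Rightarrow> 'a set"
  assumes "convergence_space X L"
    and "regular_convergence X L"
    and "hereditarily_Lindelof X L"
    and "Gfin_Bob_has_winning_strategy (conv_covers X L) (set_covers X)"
  shows "\<exists>\<K>. countable \<K> \<and> (\<forall>K\<in>\<K>. compactoid X L K) \<and> X = \<Union>\<K>"
proof -
  obtain \<sigma> where \<sigma>: "Gfin_Bob_strategy (conv_covers X L) \<sigma>"
    and win: "\<And>\<U> :: nat \<Rightarrow> 'a set set. (\<And>n. \<U> n \<in> conv_covers X L) \<Longrightarrow>
      (\<Union>n. \<sigma> (map \<U> [0..<Suc n])) \<in> set_covers X"
    using assms(4) unfolding Gfin_Bob_has_winning_strategy_def by blast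
  let ?K = "next_kernel X L \<sigma>"
  obtain W where W_countable: "\<And>s. countable (W s)" and W_covers: "\<And>s. W s \<subseteq> conv_covers X L"
    and W_miss: "\<And>s x. x \<in> X - ?K s \<Longrightarrow> \<exists>\<U>\<in>W s. x \<notin> \<Union>(\<sigma> (s @ [\<U>]))"
    using countable_moves_outside_next_kernel[OF assms(1,3), of \<sigma>] by metis
  define T where "T = (\<Union>n. move_tree W n)"
  have compactoid_K: "compactoid X L (?K s)" if "s \<in> T" for s
    using that set_move_tree_subset[of W, OF W_covers] compactoid_next_kernel[OF assms(1,2) \<sigma>]
    unfolding T_def by blast
  have "x \<in> \<Union>(?K ` T)" if x: "x \<in> X" for x
  proof (rule ccontr)
    assume "x \<notin> \<Union>(?K ` T)"
    hence "\<forall>s\<in>T. \<exists>u. u \<in> W s \<and> x \<notin> \<Union>(\<sigma> (s @ [u]))"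
      using W_miss x by blast
    then obtain f where f: "\<And>s. s \<in> T \<Longrightarrow> f s \<in> W s \<and> x \<notin> \<Union>(\<sigma> (s @ [f s]))"
      by metis
    \<comment> \<open>The branch is built as a sequence of positions, since the next move
      \<open>f s\<close> depends on the whole position \<open>s\<close>.\<close>
    define play where "play = rec_nat [] (\<lambda>_ s. s @ [f s])"
    have play_simps: "play 0 = []" "\<And>n. play (Suc n) = play n @ [f (play n)]"
      unfolding play_def by simp_all
    have play_tree: "play n \<in> move_tree W n" for n
    proof (induction n)
      case (Suc n)
      hence "f (play n) \<in> W (play n)" using f unfolding T_def by blast
      thus ?case using Suc by (auto simp: play_simps)
    qed (simp add: play_simps)
    hence play_T: "play n \<in> T" for n unfolding T_def by blast
    \<comment> \<open>This identifies the branch with the run in which Alice plays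
      \<open>f (play n)\<close> in inning \<open>n\<close>; Bob's answer there is
      \<open>\<sigma> (play (Suc n))\<close>, which misses \<open>x\<close>.\<close>
    have play_map: "map (\<lambda>n. f (play n)) [0..<n] = play n" for n
      by (induction n) (simp_all add: play_simps)
    have "(\<Union>n. \<sigma> (map (\<lambda>n. f (play n)) [0..<Suc n])) \<in> set_covers X"
      using f[OF play_T] W_covers by (intro win) blast
    hence "x \<in> \<Union>(\<Union>n. \<sigma> (play (Suc n)))"
      using x unfolding play_map set_covers_def by auto
    thus False using f[OF play_T] unfolding play_simps by blast
  qed
  moreover have "?K s \<subseteq> X" for s unfolding next_kernel_def by auto
  ultimately have "X = \<Union>(?K ` T)" by blast
  moreover have "countable (?K ` T)"
    unfolding T_def by (intro countable_image countable_UN countable_move_tree W_countable) auto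
  ultimately show ?thesis using compactoid_K by blast
qed

end
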